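(* Let $(X,f_{1,\infty})$ be a nonautonomous dynamical system on a compact metric space $X$ without isolated points. Suppose that $f_n$ converges uniformly to a continuous map $f:X\to X$. If 1. $f_{1,\infty}$ is topologically transitive, and 2. the set $AP(f_{1,\infty})$ of asymptotically periodic points is dense in $X$, then $f_{1,\infty}$ is sensitive.
   Context: $\mathbb{N}$ is the set of positive integers. A nonautonomous dynamical system is a pair $(X,f_{1,\infty})$ where $X$ is a compact metric space with metric $d$ and $f_{1,\infty}=\{f_i\}_{i=1}^\infty$ is a sequence of continuous surjective maps $f_i:X\to X$. For $i,n\in\mathbb{N}$ put $f_i^0=\mathrm{id}_X$ and $f_i^n=f_{i+(n-1)}\circ\cdots\circ f_{i+1}\circ f_i$. The system is topologically transitive if for every pair of nonempty open sets $U,V\subseteq X$ there is a positive integer $n$ such that $f_1^n(U)\cap V\neq\emptyset$. A point $x\in X$ is asymptotically periodic if there exist $r\in\mathbb{N}$ and points $x_1,\dots,x_r\in X$ such that for any $\varepsilon>0$ there is $n_0>0$ such that $d(f_1^{nr+i}(x),x_{i+1})<\varepsilon$ for all $n\geq n_0$ and $0\leq i<r$. $AP(f_{1,\infty})$ denotes the set of asymptotically periodic points. The system is sensitive if there is $\delta>0$ such that for any $x\in X$ and $\varepsilon>0$ there is $y\in X$ with $d(x,y)<\varepsilon$ such that $d(f_1^n(x),f_1^n(y))>\delta$ for some $n\geq 0$. *)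

theory Defs
  imports "HOL-Analysis.Analysis"
begin

text \<open>
  The space is a compact subset \<open>X\<close> of an ambient metric space, and a map
  \<open>X \<rightarrow> X\<close> is a total function whose values outside \<open>X\<close> are irrelevant.
  Sequences of maps are indexed from 1, so \<open>F 0\<close> plays no role.
\<close>

definition nonautonomous_system :: "'a::metric_space set \<Rightarrow> (nat \<Rightarrow> 'a \<Rightarrow> 'a) \<Rightarrow> bool"
  where "nonautonomous_system X F \<longleftrightarrow>
    compact X \<and> (\<forall>i\<ge>1. continuous_on X (F i) \<and> F i ` X = X)"

text \<open>\<open>iter F i n\<close> is $f_i^n = f_{i+(n-1)} \circ \cdots \circ f_{i+1} \circ f_i$.\<close>

primrec iter :: "(nat \<Rightarrow> 'a \<Rightarrow> 'a) \<Rightarrow> nat \<Rightarrow> nat \<Rightarrow> 'a \<Rightarrow> 'a"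
  where
    "iter F i 0 = id"
  | "iter F i (Suc n) = F (i + n) \<circ> iter F i n"

definition topologically_transitive :: "'a::metric_space set \<Rightarrow> (nat \<Rightarrow> 'a \<Rightarrow> 'a) \<Rightarrow> bool"
  where "topologically_transitive X F \<longleftrightarrow>
    (\<forall>U V. openin (top_of_set X) U \<and> U \<noteq> {} \<and> openin (top_of_set X) V \<and> V \<noteq> {} \<longrightarrow>
      (\<exists>n\<ge>1. iter F 1 n ` U \<inter> V \<noteq> {}))"

definition asymptotically_periodic ::
    "'a::metric_space set \<Rightarrow> (nat \<Rightarrow> 'a \<Rightarrow> 'a) \<Rightarrow> 'a \<Rightarrow> bool"
  where "asymptotically_periodic X F x \<longleftrightarrow>
    x \<in> X \<and>
    (\<exists>r\<ge>1. \<exists>p :: nat \<Rightarrow> 'a. (\<forall>j\<in>{1..r}. p j \<in> X) \<and>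
      (\<forall>\<epsilon>>0. \<exists>n0>0. \<forall>n\<ge>n0. \<forall>i<r. dist (iter F 1 (n * r + i) x) (p (i + 1)) < \<epsilon>))"

definition AP :: "'a::metric_space set \<Rightarrow> (nat \<Rightarrow> 'a \<Rightarrow> 'a) \<Rightarrow> 'a set"
  where "AP X F = {x. asymptotically_periodic X F x}"

definition sensitive :: "'a::metric_space set \<Rightarrow> (nat \<Rightarrow> 'a \<Rightarrow> 'a) \<Rightarrow> bool"
  where "sensitive X F \<longleftrightarrow>
    (\<exists>\<delta>>0. \<forall>x\<in>X. \<forall>\<epsilon>>0. \<exists>y\<in>X. dist x y < \<epsilon> \<and>
      (\<exists>n\<ge>0. dist (iter F 1 n x) (iter F 1 n y) > \<delta>))"

end

theory Submission
  imports Defs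
begin

text \<open>
  The idea. Because the maps converge uniformly to \<open>f\<close>, the finitely many limit points of an
  asymptotically periodic orbit form a set \<open>Q\<close> with \<open>f ` Q \<subseteq> Q\<close>
  (\<open>asymptotic_cycle_invariant\<close>). A nonempty space without isolated points is infinite, so some
  \<open>v\<close> in \<open>X\<close> lies outside \<open>Q\<close>, and \<open>\<delta>\<close> is taken to be one eighth of a lower bound for the distance from \<open>v\<close> to \<open>Q\<close>.

  If \<open>\<delta>\<close> were not a sensitivity constant, all orbits starting in some nonempty relatively open set
  \<open>U\<close> would stay together. By density \<open>U\<close> contains an asymptotically periodic point, of period
  \<open>r\<close> say, so every orbit from \<open>U\<close> eventually moves, up to \<open>3\<delta>\<close>, in step through the same \<open>r\<close>
  points \<open>p\<close>. Absence of isolated points lets transitivity act at arbitrarily late times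
  (\<open>transitive_late_hit\<close>), which is used twice.
  First, some orbit from \<open>U\<close> comes, at a late time, extremely close to \<open>Q\<close>. At late times the
  system is nearly autonomous, so this orbit then stays within \<open>\<delta>\<close> of \<open>Q\<close> for \<open>r\<close> consecutive
  steps (\<open>late_shadowing\<close>); during these it passes near each of the points \<open>p\<close>,
  and hence all of them are within \<open>4\<delta>\<close> of \<open>Q\<close>. Secondly, some orbit
  from \<open>U\<close> comes late within \<open>\<delta>\<close> of \<open>v\<close>, which puts \<open>v\<close> at distance less than
  \<open>\<delta> + 3\<delta> + 4\<delta>\<close> from \<open>Q\<close>, a contradiction.

  The set \<open>Q\<close> is fixed before \<open>\<delta>\<close>, while the period \<open>r\<close> depends on \<open>\<delta>\<close>; only the
  closeness to \<open>Q\<close> demanded of the first visit has to depend on \<open>r\<close>.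
\<close>

section \<open>Iterates\<close>

lemma iter_add: "iter F i (m + n) x = iter F (i + m) n (iter F i m x)"
  by (induction n) (simp_all add: add.assoc)

lemma iter_in_space:
  assumes "nonautonomous_system X F" "1 \<le> i" "x \<in> X"
  shows "iter F i n x \<in> X"
proof (induction n)
  case (Suc n)
  have "F (i + n) ` X = X"
    using assms by (simp add: nonautonomous_system_def)
  with Suc show ?case by auto
qed (simp add: assms)

lemma continuous_on_iter:
  assumes "nonautonomous_system X F" "1 \<le> i"
  shows "continuous_on X (iter F i n)"
proof (induction n)
  case (Suc n)
  have "iter F i n ` X \<subseteq> X"
    using iter_in_space[OF assms] by auto
  moreover have "continuous_on X (F (i + n))"
    using assms by (simp add: nonautonomous_system_def)
  ultimately have "continuous_on X (F (i + n) \<circ> iter F i n)"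
    using Suc continuous_on_compose continuous_on_subset by blast
  then show ?case by simp
qed (simp add: id_def)

section \<open>Transitivity at late times\<close>

lemma infinite_openin_no_isolated:
  assumes "\<forall>x\<in>X. \<not> x isolated_in X" "openin (top_of_set X) V" "V \<noteq> {}"
  shows "infinite (V :: 'a::metric_space set)"
proof -
  obtain T where T: "open T" "V = X \<inter> T"
    using assms(2) by (auto simp: openin_open)
  obtain v where v: "v \<in> V" using assms(3) by auto
  then have "v islimpt X"
    using assms(1) T by (auto simp: isolated_in_islimpt_iff)
  then have "v islimpt V"
    using T v by (metis IntE islimpt_Int_eventually eventually_at_in_open')
  then show ?thesis
    using islimpt_finite by blast
qed

text \<open>
  Transitivity only promises some hitting time, but finitely many early times can be ruled out:
  the first iterates of a point \<open>x\<close> of \<open>U\<close> do not exhaust the infinite set \<open>V\<close>, so \<open>U\<close> and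
  \<open>V\<close> can be shrunk around \<open>x\<close> and a point of \<open>V\<close> off these iterates until no early hit remains.
\<close>
lemma transitive_late_hit:
  fixes X :: "'a::metric_space set"
  assumes sys: "nonautonomous_system X F"
    and iso: "\<forall>x\<in>X. \<not> x isolated_in X"
    and trans: "topologically_transitive X F"
    and U: "openin (top_of_set X) U" "U \<noteq> {}"
    and V: "openin (top_of_set X) V" "V \<noteq> {}"
  obtains n u where "N \<le> n" "u \<in> U" "iter F 1 n u \<in> V"
proof -
  obtain x where x: "x \<in> U" using U by auto
  define S where "S = (\<lambda>n. iter F 1 n x) ` {..<N}"
  have "infinite V"
    using infinite_openin_no_isolated[OF iso V] .
  then obtain v where v: "v \<in> V" "v \<notin> S"
    using finite_subset[of V S] by (auto simp: S_def)
  obtain e where e: "e > 0" "\<forall>s\<in>S. s \<noteq> v \<longrightarrow> e \<le> dist v s"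
    using finite_set_avoid[of S v] by (auto simp: S_def)
  define U' where "U' = U \<inter> (\<Inter>n\<in>{..<N}. {u \<in> X. e / 2 < dist v (iter F 1 n u)})"
  define V' where "V' = V \<inter> ball v (e / 2)"
  have opn: "openin (top_of_set X) {u \<in> X. e / 2 < dist v (iter F 1 n u)}" for n
  proof -
    have "continuous_on X (\<lambda>u. dist v (iter F 1 n u))"
      using continuous_on_iter[OF sys, of 1 n] by (intro continuous_intros) auto
    then have "openin (top_of_set X) (X \<inter> (\<lambda>u. dist v (iter F 1 n u)) -` {e / 2<..})"
      by (rule continuous_openin_preimage_gen) auto
    then show ?thesis by (simp add: vimage_def Int_def)
  qed
  have "U \<subseteq> X" using U openin_imp_subset by auto
  have "openin (top_of_set X) U'"
  proof (cases "N = 0")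
    case False
    then have "openin (top_of_set X) (\<Inter>n\<in>{..<N}. {u \<in> X. e / 2 < dist v (iter F 1 n u)})"
      using opn by (intro openin_INT2) auto
    then show ?thesis unfolding U'_def using U by blast
  qed (use U in \<open>simp add: U'_def\<close>)
  moreover have "openin (top_of_set X) V'"
    unfolding V'_def using V by (meson open_ball openin_Int_open)
  moreover have "e / 2 < dist v (iter F 1 n x)" if "n < N" for n
  proof -
    have "iter F 1 n x \<in> S" using that by (auto simp: S_def)
    then have "e \<le> dist v (iter F 1 n x)" using e v by metis
    then show ?thesis using e by linarith
  qed
  then have "x \<in> U'" using x \<open>U \<subseteq> X\<close> by (auto simp: U'_def)
  moreover have "v \<in> V'" using v e by (simp add: V'_def)
  ultimately obtain n u where n: "u \<in> U'" "iter F 1 n u \<in> V'"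
    using trans unfolding topologically_transitive_def by blast
  have "N \<le> n"
  proof (rule ccontr)
    assume "\<not> N \<le> n"
    then have "e / 2 < dist v (iter F 1 n u)" using n(1) by (simp add: U'_def)
    then show False using n(2) by (simp add: V'_def)
  qed
  moreover have "u \<in> U" "iter F 1 n u \<in> V"
    using n by (simp_all add: U'_def V'_def)
  ultimately show thesis by (rule that)
qed

section \<open>Limit cycles of asymptotically periodic points\<close>

text \<open>
  Asymptotic periodicity read along the whole orbit, the target at time \<open>m\<close> being chosen by
  the residue of \<open>m\<close>; this is the form in which several orbits can be compared at one time.
\<close>
lemma asymptotically_periodicE:
  assumes "asymptotically_periodic X F x"
  obtains r p where "r \<ge> 1" "\<And>i. i < r \<Longrightarrow> p (i + 1) \<in> X"
    "\<And>e. e > 0 \<Longrightarrow> \<exists>N. \<forall>m\<ge>N. dist (iter F 1 m x) (p (m mod r + 1)) < e"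
proof -
  obtain r p where r: "r \<ge> 1" and p: "\<forall>j\<in>{1..r}. p j \<in> X"
    and lim: "\<forall>e>0. \<exists>n0>0. \<forall>n\<ge>n0. \<forall>i<r. dist (iter F 1 (n * r + i) x) (p (i + 1)) < e"
    using assms unfolding asymptotically_periodic_def by blast
  have "p (i + 1) \<in> X" if "i < r" for i
    using p that by simp
  moreover have "\<exists>N. \<forall>m\<ge>N. dist (iter F 1 m x) (p (m mod r + 1)) < e" if "e > 0" for e
  proof -
    obtain n0 where n0: "\<forall>n\<ge>n0. \<forall>i<r. dist (iter F 1 (n * r + i) x) (p (i + 1)) < e"
      using lim \<open>e > 0\<close> by blast
    have "dist (iter F 1 m x) (p (m mod r + 1)) < e" if "m \<ge> n0 * r" for m
    proof -
      have "n0 \<le> m div r"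
        using that r by (simp add: less_eq_div_iff_mult_less_eq)
      moreover have "m mod r < r" using r by simp
      ultimately have "dist (iter F 1 (m div r * r + m mod r) x) (p (m mod r + 1)) < e"
        using n0 by blast
      then show ?thesis by simp
    qed
    then show ?thesis by blast
  qed
  ultimately show thesis by (rule that[OF r])
qed

text \<open>
  The image \<open>f w\<close> of a limit point \<open>w\<close> of the orbit is again approached by the orbit, one step
  after the visits to \<open>w\<close>; since the orbit eventually stays near the finite, hence closed, set
  of its limit points, \<open>f w\<close> lies in that set.
\<close>
lemma asymptotic_cycle_invariant:
  fixes X :: "'a::metric_space set"
  assumes sys: "nonautonomous_system X F"
    and f: "continuous_on X f"
    and lim: "uniform_limit X F f sequentially"
    and ap: "asymptotically_periodic X F x"
  obtains Q where "finite Q" "Q \<noteq> {}" "Q \<subseteq> X" "f ` Q \<subseteq> Q"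
proof -
  obtain r p where r: "r \<ge> 1" and pX: "\<And>i. i < r \<Longrightarrow> p (i + 1) \<in> X"
    and p: "\<And>e. e > 0 \<Longrightarrow> \<exists>N. \<forall>m\<ge>N. dist (iter F 1 m x) (p (m mod r + 1)) < e"
    using asymptotically_periodicE[OF ap] by metis
  have x: "x \<in> X" using ap by (simp add: asymptotically_periodic_def)
  define Q where "Q = (\<lambda>i. p (i + 1)) ` {..<r}"
  have finQ: "finite Q" by (simp add: Q_def)
  have inQ: "p (m mod r + 1) \<in> Q" for m
    using r by (simp add: Q_def)
  have "f (p (i + 1)) \<in> Q" if i: "i < r" for i
  proof -
    have "\<exists>w\<in>Q. dist w (f (p (i + 1))) < e" if "e > 0" for e
    proof -
      obtain d where d: "d > 0"
        "\<And>z. z \<in> X \<Longrightarrow> dist z (p (i + 1)) < d \<Longrightarrow> dist (f z) (f (p (i + 1))) < e / 3"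
        using f pX[OF i] \<open>e > 0\<close> unfolding continuous_on_iff
        by (metis divide_pos_pos zero_less_numeral)
      obtain N1 where N1: "\<forall>m\<ge>N1. dist (iter F 1 m x) (p (m mod r + 1)) < d"
        using p[OF d(1)] by blast
      obtain N2 where N2: "\<forall>m\<ge>N2. dist (iter F 1 m x) (p (m mod r + 1)) < e / 3"
        using p[of "e / 3"] \<open>e > 0\<close> by auto
      obtain N3 where N3: "\<forall>m\<ge>N3. \<forall>z\<in>X. dist (F m z) (f z) < e / 3"
        using uniform_limitD[OF lim, of "e / 3"] \<open>e > 0\<close>
        unfolding eventually_sequentially by auto
      define m where "m = (N1 + N2 + N3) * r + i"
      have m: "m mod r = i" "m \<ge> N1" "m \<ge> N2" "m \<ge> N3"
      proof -
        have "N1 + N2 + N3 \<le> (N1 + N2 + N3) * r" using r by simp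
        then show "m \<ge> N1" "m \<ge> N2" "m \<ge> N3" unfolding m_def by linarith+
      qed (use i in \<open>simp add: m_def\<close>)
      have "dist (f (iter F 1 m x)) (f (p (i + 1))) < e / 3"
        using N1 m d(2) iter_in_space[OF sys _ x] by force
      moreover have "dist (iter F 1 (Suc m) x) (f (iter F 1 m x)) < e / 3"
        using N3 m iter_in_space[OF sys _ x] by simp
      moreover have "dist (iter F 1 (Suc m) x) (p (Suc m mod r + 1)) < e / 3"
        using N2 m by (metis le_SucI)
      ultimately have "dist (p (Suc m mod r + 1)) (f (p (i + 1))) < e"
        by metric
      then show ?thesis using inQ by blast
    qed
    moreover have "closed Q" using finQ by (rule finite_imp_closed)
    ultimately show ?thesis using closed_approachable by blast
  qed
  then have "f ` Q \<subseteq> Q" by (auto simp: Q_def)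
  moreover have "Q \<subseteq> X" using pX by (auto simp: Q_def)
  ultimately show thesis using that[OF finQ] inQ by blast
qed

section \<open>Shadowing the limit map\<close>

text \<open>
  Over a fixed number of steps the late maps \<open>F m\<close> are uniformly as close to \<open>f\<close> as desired, so
  the errors accumulated along a finite piece of an \<open>f\<close>-orbit are controlled by continuity.
\<close>
lemma late_shadowing:
  fixes X :: "'a::metric_space set"
  assumes sys: "nonautonomous_system X F"
    and f: "continuous_on X f" "f ` X \<subseteq> X"
    and lim: "uniform_limit X F f sequentially"
    and q: "q \<in> X"
    and "e > 0"
  shows "\<exists>N. \<exists>\<rho>>0. \<forall>k\<ge>N. \<forall>y\<in>X. dist y q < \<rho> \<longrightarrow>
           (\<forall>j\<le>r. dist (iter F (1 + k) j y) ((f ^^ j) q) < e)"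
  using \<open>e > 0\<close>
proof (induction r arbitrary: e)
  case 0
  then show ?case by auto
next
  case (Suc r)
  have fq: "(f ^^ j) q \<in> X" for j
    using f(2) q by (induction j) auto
  obtain d where d: "d > 0"
    "\<And>z. z \<in> X \<Longrightarrow> dist z ((f ^^ r) q) < d \<Longrightarrow> dist (f z) (f ((f ^^ r) q)) < e / 2"
    using f(1) fq[of r] \<open>e > 0\<close> unfolding continuous_on_iff by (metis half_gt_zero)
  obtain M where M: "\<forall>m\<ge>M. \<forall>z\<in>X. dist (F m z) (f z) < e / 2"
    using uniform_limitD[OF lim, of "e / 2"] \<open>e > 0\<close> unfolding eventually_sequentially by auto
  obtain N \<rho> where \<rho>: "\<rho> > 0" and N: "\<forall>k\<ge>N. \<forall>y\<in>X. dist y q < \<rho> \<longrightarrow>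
      (\<forall>j\<le>r. dist (iter F (1 + k) j y) ((f ^^ j) q) < min e d)"
    using Suc.IH[of "min e d"] \<open>e > 0\<close> d(1) by auto
  have "dist (iter F (1 + k) j y) ((f ^^ j) q) < e"
    if k: "k \<ge> max M N" and y: "y \<in> X" "dist y q < \<rho>" and j: "j \<le> Suc r" for k y j
  proof (cases "j \<le> r")
    case True
    then show ?thesis using N k y by (simp add: max_def split: if_splits)
  next
    case False
    with j have j: "j = Suc r" by simp
    define z where "z = iter F (1 + k) r y"
    have z: "z \<in> X" unfolding z_def using iter_in_space[OF sys _ y(1)] by simp
    have "dist z ((f ^^ r) q) < d" using N k y by (simp add: z_def)
    then have "dist (f z) (f ((f ^^ r) q)) < e / 2" using d z by blast
    moreover have "dist (F (1 + k + r) z) (f z) < e / 2"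
      using M z k by simp
    ultimately have "dist (F (1 + k + r) z) (f ((f ^^ r) q)) < e" by metric
    then show ?thesis by (simp add: j z_def)
  qed
  with \<rho> show ?case by blast
qed

section \<open>Sensitivity\<close>

theorem theorem5:
  fixes X :: "'a::metric_space set"
    and F :: "nat \<Rightarrow> 'a \<Rightarrow> 'a"
    and f :: "'a \<Rightarrow> 'a"
  assumes "nonautonomous_system X F"
    and "\<forall>x\<in>X. \<not> x isolated_in X"
    and "continuous_on X f" and "f ` X \<subseteq> X"
    and "uniform_limit X F f sequentially"
    and "topologically_transitive X F"
    and "X \<subseteq> closure (AP X F)"
  shows "sensitive X F"
proof (cases "X = {}")
  case True
  then show ?thesis by (auto simp: sensitive_def intro: exI[of _ 1])
next
  case False
  note hit = transitive_late_hit[OF assms(1,2,6)]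
  have "AP X F \<noteq> {}"
    using False assms(7) by auto
  then obtain a0 where "asymptotically_periodic X F a0"
    by (auto simp: AP_def)
  then obtain Q where Q: "finite Q" "Q \<noteq> {}" "Q \<subseteq> X" "f ` Q \<subseteq> Q"
    using asymptotic_cycle_invariant[OF assms(1,3,5)] by blast
  have "infinite X"
    using infinite_openin_no_isolated[OF assms(2), of X] False by simp
  then have "\<not> X \<subseteq> Q"
    using Q(1) finite_subset by metis
  then obtain v where v: "v \<in> X" "v \<notin> Q"
    by blast
  obtain c where c: "c > 0" "\<forall>w\<in>Q. c \<le> dist v w"
    using finite_set_avoid[OF Q(1), of v] v(2) by metis
  define \<delta> where "\<delta> = c / 8"
  have \<delta>: "\<delta> > 0" using c by (simp add: \<delta>_def)
  obtain q where q: "q \<in> Q" using Q by blast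
  have fq: "(f ^^ j) q \<in> Q" for j
    using Q(4) q by (induction j) auto
  have "\<exists>y\<in>X. dist x y < \<epsilon> \<and> (\<exists>n\<ge>0. dist (iter F 1 n x) (iter F 1 n y) > \<delta>)"
    if x: "x \<in> X" and "\<epsilon> > 0" for x \<epsilon>
  proof (rule ccontr)
    define U where "U = X \<inter> ball x \<epsilon>"
    assume "\<not> ?thesis"
    then have stay: "dist (iter F 1 n x) (iter F 1 n y) \<le> \<delta>" if "y \<in> U" for y n
      using that by (auto simp: U_def not_less)
    have U: "openin (top_of_set X) U" "U \<noteq> {}"
      using x \<open>\<epsilon> > 0\<close> by (auto simp: U_def)
    obtain a where "a \<in> AP X F" "dist a x < \<epsilon>"
      using assms(7) x \<open>\<epsilon> > 0\<close> closure_approachable by blast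
    then have a: "a \<in> U" "asymptotically_periodic X F a"
      by (auto simp: U_def AP_def asymptotically_periodic_def dist_commute)
    obtain r p where r: "r \<ge> 1"
      and p: "\<And>e. e > 0 \<Longrightarrow> \<exists>N. \<forall>m\<ge>N. dist (iter F 1 m a) (p (m mod r + 1)) < e"
      using asymptotically_periodicE[OF a(2)] by metis
    obtain N1 where N1: "\<forall>m\<ge>N1. dist (iter F 1 m a) (p (m mod r + 1)) < \<delta>"
      using p[OF \<delta>] by blast
    have near_p: "dist (iter F 1 m y) (p (m mod r + 1)) < 3 * \<delta>" if "y \<in> U" "m \<ge> N1" for y m
    proof -
      have "dist (iter F 1 m a) (p (m mod r + 1)) < \<delta>" using N1 that by blast
      with stay[OF a(1), of m] stay[OF that(1), of m] show ?thesis by metric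
    qed
    obtain N2 \<rho> where \<rho>: "\<rho> > 0" and N2: "\<forall>k\<ge>N2. \<forall>y\<in>X. dist y q < \<rho> \<longrightarrow>
        (\<forall>j\<le>r. dist (iter F (1 + k) j y) ((f ^^ j) q) < \<delta>)"
      using late_shadowing[OF assms(1,3,4,5) _ \<delta>, of q r] Q(3) q by blast
    have "openin (top_of_set X) (X \<inter> ball q \<rho>)" "X \<inter> ball q \<rho> \<noteq> {}"
      using Q(3) q \<rho> by auto
    then obtain k y where k: "k \<ge> N1 + N2" and y: "y \<in> U" "iter F 1 k y \<in> X \<inter> ball q \<rho>"
      by (rule hit[OF U])
    have p_near_Q: "\<exists>w\<in>Q. dist (p (i + 1)) w < 4 * \<delta>" if i: "i < r" for i
    proof -
      \<comment> \<open>among \<open>r\<close> consecutive times there is one in the residue class of \<open>i\<close>\<close>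
      define j where "j = (i + (r - k mod r)) mod r"
      have "(k + j) mod r = (k mod r + (i + (r - k mod r))) mod r"
        by (simp only: j_def mod_add_left_eq mod_add_right_eq)
      also have "k mod r + (i + (r - k mod r)) = i + r"
        using r mod_less_divisor[of r k] by linarith
      finally have kj: "(k + j) mod r = i" using i by simp
      have "j \<le> r" using r mod_less_divisor[of r "i + (r - k mod r)"] by (simp add: j_def)
      then have "dist (iter F (1 + k) j (iter F 1 k y)) ((f ^^ j) q) < \<delta>"
        using N2 k y by (simp add: dist_commute)
      then have "dist (iter F 1 (k + j) y) ((f ^^ j) q) < \<delta>"
        by (simp add: iter_add)
      moreover have "dist (iter F 1 (k + j) y) (p (i + 1)) < 3 * \<delta>"
        using near_p[OF y(1), of "k + j"] k kj by simp
      ultimately have "dist (p (i + 1)) ((f ^^ j) q) < 4 * \<delta>" by metric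
      then show ?thesis using fq by blast
    qed
    have "openin (top_of_set X) (X \<inter> ball v \<delta>)" "X \<inter> ball v \<delta> \<noteq> {}"
      using v \<delta> by auto
    then obtain m z where m: "m \<ge> N1" and z: "z \<in> U" "iter F 1 m z \<in> X \<inter> ball v \<delta>"
      by (rule hit[OF U])
    obtain w where w: "w \<in> Q" "dist (p (m mod r + 1)) w < 4 * \<delta>"
      using p_near_Q[of "m mod r"] r by auto
    have "dist v (iter F 1 m z) < \<delta>" using z by simp
    with near_p[OF z(1) m] w(2) have "dist v w < 8 * \<delta>" by metric
    moreover have "c \<le> dist v w" using c w(1) by blast
    ultimately show False by (simp add: \<delta>_def)
  qed
  then show ?thesis
    unfolding sensitive_def by (intro exI[of _ \<delta>] conjI ballI allI impI \<delta>)
qed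

end
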